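(* Let $k\ge 1$ be an integer and let $\mathcal{D}_k$ denote the set of Dyck paths of length $2k$. For $p\in\mathcal{D}_k$ and $0\le i\le k-1$, let $R_i(p)$ be the number of rise steps of $p$ going from altitude $i$ to altitude $i+1$, and let $\vec R(p)=(R_0(p),\dots,R_{k-1}(p))$. Let $E$ denote expectation with respect to the uniform distribution on $\mathcal{D}_k$. Then \[ \| E[\vec{R}]\|_2^2 \;=\; \frac{1}{C_k^2}\sum_{p_1,p_2\in\mathcal{D}_k}\sum_{i=0}^{k-1} R_i(p_1)R_i(p_2) \;=\; \frac{C_{2k}}{C_k^2}-1, \] where $C_m=\frac{1}{m+1}\binom{2m}{m}$ is the $m$-th Catalan number.
   Context: A Dyck path of length $2k$ is a lattice path made of $2k$ steps, each either a rise $(1,1)$ or a fall $(1,-1)$, starting at $(0,0)$, ending at $(2k,0)$, and never going below the $x$-axis. The altitude of a point is its $y$-coordinate. $|\mathcal{D}_k|=C_k$. *)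

theory Defs
  imports "HOL-Probability.Probability"
begin

definition catalan :: "nat \<Rightarrow> real" where
  "catalan m = 1 / (real m + 1) * real ((2 * m) choose m)"

datatype step = Rise | Fall

fun displacement :: "step \<Rightarrow> int \<times> int" where
  "displacement Rise = (1, 1)"
| "displacement Fall = (1, - 1)"

text \<open>A path is given by its list of steps and starts at the origin;
  \<open>vertex p j\<close> is the lattice point reached after the first \<open>j\<close> steps.\<close>

definition vertex :: "step list \<Rightarrow> nat \<Rightarrow> int \<times> int" where
  "vertex p j = sum_list (map displacement (take j p))"

definition altitude :: "step list \<Rightarrow> nat \<Rightarrow> int" where
  "altitude p j = snd (vertex p j)"

definition dyck_paths :: "nat \<Rightarrow> step list set" where
  "dyck_paths k = {p. length p = 2 * k \<and> vertex p (2 * k) = (int (2 * k), 0) \<and>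
                      (\<forall>j\<le>2 * k. 0 \<le> altitude p j)}"

definition rises :: "nat \<Rightarrow> step list \<Rightarrow> nat" where
  "rises i p = card {j. j < length p \<and> p ! j = Rise \<and>
                        altitude p j = int i \<and> altitude p (Suc j) = int i + 1}"

text \<open>The next two facts make \<open>pmf_of_set (dyck_paths k)\<close> the uniform distribution
  (\<open>pmf_of_set\<close> is only meaningful on finite nonempty sets).\<close>

lemma finite_dyck_paths: "finite (dyck_paths k)"
proof -
  have "(UNIV :: step set) = {Rise, Fall}"
    using step.exhaust by auto
  then have "finite (UNIV :: step set)"
    by (metis finite.emptyI finite_insert)
  then have "finite {p :: step list. set p \<subseteq> UNIV \<and> length p = 2 * k}"
    by (rule finite_lists_length_eq)
  then show ?thesis
    by (rule rev_finite_subset) (auto simp: dyck_paths_def)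
qed

lemma dyck_paths_nonempty: "dyck_paths k \<noteq> {}"
proof -
  have rise: "sum_list (map displacement (replicate n Rise)) = (int n, int n)" for n
    by (induction n) (auto simp: zero_prod_def)
  have fall: "sum_list (map displacement (replicate n Fall)) = (int n, - int n)" for n
    by (induction n) (auto simp: zero_prod_def)
  have "vertex (replicate k Rise @ replicate k Fall) j =
      (int (min j k) + int (min (j - k) k), int (min j k) - int (min (j - k) k))" for j
    by (simp only: vertex_def take_append map_append sum_list_append take_replicate rise fall)
       simp
  then have "replicate k Rise @ replicate k Fall \<in> dyck_paths k"
    by (auto simp: dyck_paths_def altitude_def)
  then show ?thesis by blast
qed

text \<open>The expectation of the vector \<open>R\<close> is taken componentwise.\<close>

definition expected_rises :: "nat \<Rightarrow> nat \<Rightarrow> real" where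
  "expected_rises k i =
     measure_pmf.expectation (pmf_of_set (dyck_paths k)) (\<lambda>p. real (rises i p))"

end

theory Submission
  imports Defs
begin

text \<open>
  Let \<open>B n h\<close> be the number of nonnegative paths with \<open>n\<close> steps from altitude \<open>h\<close> to altitude \<open>0\<close>.
  The total number of rises from altitude \<open>i\<close> over all Dyck paths of length \<open>2k\<close> is
  \<open>B (2k) (2i + 2)\<close>: cutting at a rise and reversing the second part gives a path to altitude \<open>i\<close>,
  a rise, and a path climbing \<open>i + 1\<close> further, which is the decomposition at the last visit to
  altitude \<open>i\<close> of a path to altitude \<open>2i + 2\<close>. On the other hand, cutting a
  Dyck path of length \<open>4k\<close> in the middle gives
  \<open>C\<^bsub>2k\<^esub> = (\<Sum>h. (B (2k) h)\<^sup>2)\<close>, in which only even \<open>h\<close> contribute and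
  \<open>h = 0\<close> contributes \<open>C\<^bsub>k\<^esub>\<^sup>2\<close>.
\<close>

section \<open>Ballot numbers\<close>

fun ballot :: "nat \<Rightarrow> nat \<Rightarrow> nat" where
  "ballot 0 h = (if h = 0 then 1 else 0)"
| "ballot (Suc n) 0 = ballot n 1"
| "ballot (Suc n) (Suc h) = ballot n h + ballot n (Suc (Suc h))"

lemma ballot_eq_0: "n < h \<Longrightarrow> ballot n h = 0"
  by (induction n h rule: ballot.induct) auto

lemma ballot_eq_0_parity: "odd (n + h) \<Longrightarrow> ballot n h = 0"
  by (induction n h rule: ballot.induct) (auto simp: odd_pos)

text \<open>Reflection principle: of the paths with \<open>m\<close> rises, those that go negative
  number \<open>n choose (m - 1)\<close>. The additive form avoids subtraction on
  \<open>nat\<close>; the \<open>if\<close> is needed because \<open>m - 1\<close> truncates at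
  \<open>m = 0\<close>.\<close>

lemma ballot_add_binomial:
  assumes "n = 2 * m + h"
  shows "ballot n h + (if m = 0 then 0 else n choose (m - 1)) = n choose m"
  using assms
proof (induction n arbitrary: m h)
  case 0
  then show ?case by simp
next
  case (Suc n)
  show ?case
  proof (cases m)
    case 0
    then obtain h' where h: "h = Suc h'" using Suc.prems by (cases h) auto
    have "ballot n h' = 1" using Suc.IH[of 0 h'] Suc.prems 0 h by simp
    moreover have "ballot n (Suc (Suc h')) = 0"
      using Suc.prems 0 h by (intro ballot_eq_0) simp
    ultimately show ?thesis using 0 h by simp
  next
    case (Suc q)
    have up: "ballot n (Suc h) + (if q = 0 then 0 else n choose (q - 1)) = n choose q"
      using Suc.IH[of q "Suc h"] Suc.prems Suc by simp
    have pascal: "Suc n choose q = (n choose q) + (if q = 0 then 0 else n choose (q - 1))"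
      by (cases q) auto
    show ?thesis
    proof (cases h)
      case 0
      \<comment> \<open>Here \<open>n = 2 * q + 1\<close>, so both middle binomials agree; this
        makes up for the missing downward branch at altitude 0.\<close>
      have "n choose Suc q = n choose q"
        using binomial_symmetric[of q n] Suc.prems Suc 0 by (simp add: Suc_diff_le)
      then show ?thesis using up pascal Suc 0 by simp
    next
      case h: (Suc h')
      have "ballot n h' + (n choose q) = n choose Suc q"
        using Suc.IH[of "Suc q" h'] Suc.prems Suc h by simp
      then show ?thesis using up pascal Suc h by simp
    qed
  qed
qed

lemma catalan_eq_ballot: "catalan k = real (ballot (2 * k) 0)"
proof (cases k)
  case 0
  then show ?thesis by (simp add: catalan_def)
next
  case (Suc q)
  let ?n = "2 * k"
  \<comment> \<open>With \<open>q = k - 1\<close>, two absorption identities express the subtracted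
    binomial through the central one.\<close>
  have "(?n - q) * (?n choose q) = ?n * ((?n - 1) choose q)"
    by (rule binomial_absorb_comp)
  also have "\<dots> = k * (?n choose k)"
    using binomial_absorption[of q ?n] Suc by simp
  finally have "(k + 1) * (?n choose q) = k * (?n choose k)"
    using Suc by simp
  then have "(real k + 1) * real (?n choose q) = real k * real (?n choose k)"
    by (metis of_nat_1 of_nat_add of_nat_mult)
  moreover have "real (ballot ?n 0) + real (?n choose q) = real (?n choose k)"
    using ballot_add_binomial[of ?n k 0] Suc by (simp flip: of_nat_add)
  ultimately have "(real k + 1) * real (ballot ?n 0) = real (?n choose k)"
    by (smt (verit) distrib_left distrib_right mult_cancel_right1)
  then show ?thesis by (simp add: catalan_def field_simps)
qed

text \<open>This counts paths by their altitude after \<open>m\<close> steps, the first part being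
  reversed. The induction moves one step from the first factor to the second: the one-step recursion
  is symmetric in the two altitudes, and \<open>m < N\<close> removes the terms at the upper
  boundary.\<close>

lemma sum_ballot_mult:
  assumes "m < N"
  shows "(\<Sum>h<N. ballot m h * ballot n h) = ballot (m + n) 0"
  using assms
proof (induction m arbitrary: n)
  case 0
  then obtain M where M: "N = Suc M" by (cases N) auto
  show ?case unfolding M sum.lessThan_Suc_shift by simp
next
  case (Suc m)
  then obtain M where M: "N = Suc M" by (cases N) auto
  have "ballot m M = 0" "ballot m (Suc M) = 0"
    using Suc.prems M by (auto intro: ballot_eq_0)
  then have "(\<Sum>h<M. ballot m (Suc (Suc h)) * ballot n (Suc h)) + ballot m 1 * ballot n 0 =
      (\<Sum>h<M. ballot m (Suc h) * ballot n h)"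
    using sum.lessThan_Suc_shift[of "\<lambda>h. ballot m (Suc h) * ballot n h" M] by simp
  moreover have "(\<Sum>h<M. ballot m (Suc h) * ballot n (Suc (Suc h))) + ballot m 0 * ballot n 1 =
      (\<Sum>h<M. ballot m h * ballot n (Suc h))"
    using sum.lessThan_Suc_shift[of "\<lambda>h. ballot m h * ballot n (Suc h)" M] \<open>ballot m M = 0\<close>
    by simp
  ultimately have "(\<Sum>h<N. ballot (Suc m) h * ballot n h) =
      (\<Sum>h<N. ballot m h * ballot (Suc n) h)"
    unfolding M sum.lessThan_Suc_shift by (simp add: algebra_simps sum.distrib)
  then show ?case using Suc.IH[of "Suc n"] Suc.prems by simp
qed

lemma sum_lessThan_double:
  fixes f :: "nat \<Rightarrow> 'a::comm_monoid_add"
  shows "(\<Sum>h<2 * N. f h) = (\<Sum>i<N. f (2 * i) + f (2 * i + 1))"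
  by (induction N) (simp_all add: add_ac)

lemma ballot_square_sum:
  "ballot (4 * k) 0 = (ballot (2 * k) 0)\<^sup>2 + (\<Sum>i<k. (ballot (2 * k) (2 * i + 2))\<^sup>2)"
proof -
  \<comment> \<open>The bound \<open>2 * Suc k\<close> exceeds \<open>2 * k\<close>, as the cut
    requires, and is even, so altitudes pair up by parity.\<close>
  have "ballot (4 * k) 0 = (\<Sum>h<2 * Suc k. ballot (2 * k) h * ballot (2 * k) h)"
    using sum_ballot_mult[of "2 * k" "2 * Suc k" "2 * k"] by simp
  also have "\<dots> = (\<Sum>i<Suc k. (ballot (2 * k) (2 * i))\<^sup>2)"
    unfolding sum_lessThan_double by (simp add: ballot_eq_0_parity power2_eq_square)
  also have "\<dots> = (ballot (2 * k) 0)\<^sup>2 + (\<Sum>i<k. (ballot (2 * k) (2 * i + 2))\<^sup>2)"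
    unfolding sum.lessThan_Suc_shift by simp
  finally show ?thesis .
qed

section \<open>Counting rises in Dyck paths\<close>

lemma altitude_0 [simp]: "altitude p 0 = 0"
  by (simp add: altitude_def vertex_def zero_prod_def)

lemma altitude_Cons_Suc [simp]:
  "altitude (s # p) (Suc j) = snd (displacement s) + altitude p j"
  by (simp add: altitude_def vertex_def)

lemma altitude_Suc:
  "j < length p \<Longrightarrow> altitude p (Suc j) = altitude p j + snd (displacement (p ! j))"
  by (simp add: altitude_def vertex_def take_Suc_conv_app_nth)

text \<open>\<open>altitude\<close> is relative to the start of the list, hence the offset
  \<open>h\<close>. A free starting altitude allows induction on the first step.\<close>

definition dyck_paths_from :: "nat \<Rightarrow> nat \<Rightarrow> step list set" where
  "dyck_paths_from h n = {p. length p = n \<and> int h + altitude p n = 0 \<and>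
                             (\<forall>j\<le>n. 0 \<le> int h + altitude p j)}"

text \<open>Each step has horizontal displacement 1, so the abscissa of the endpoint is determined
  by the length.\<close>

lemma dyck_paths_eq: "dyck_paths k = dyck_paths_from 0 (2 * k)"
proof -
  have "fst (vertex p (length p)) = int (length p)" for p
  proof (induction p)
    case (Cons s p)
    then show ?case by (cases s) (auto simp: vertex_def)
  qed (simp add: vertex_def zero_prod_def)
  then show ?thesis
    by (auto simp: dyck_paths_def dyck_paths_from_def altitude_def prod_eq_iff)
      (metis of_nat_mult of_nat_numeral)
qed

lemma all_le_Suc: "(\<forall>j\<le>Suc n. P j) \<longleftrightarrow> P 0 \<and> (\<forall>j\<le>n. P (Suc j))"
  by (metis Suc_le_mono le0 not0_implies_Suc)

lemma dyck_paths_from_0: "dyck_paths_from h 0 = (if h = 0 then {[]} else {})"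
  by (auto simp: dyck_paths_from_def)

lemma Cons_mem_dyck_paths_from:
  "Rise # p \<in> dyck_paths_from h (Suc n) \<longleftrightarrow> p \<in> dyck_paths_from (Suc h) n"
  "Fall # p \<in> dyck_paths_from h (Suc n) \<longleftrightarrow> h > 0 \<and> p \<in> dyck_paths_from (h - 1) n"
proof -
  show "Rise # p \<in> dyck_paths_from h (Suc n) \<longleftrightarrow> p \<in> dyck_paths_from (Suc h) n"
    by (auto simp: dyck_paths_from_def all_le_Suc algebra_simps)
  have "h > 0" if "\<forall>j\<le>n. 0 \<le> int h - 1 + altitude p j"
    using that[rule_format, of 0] by simp
  then show "Fall # p \<in> dyck_paths_from h (Suc n) \<longleftrightarrow> h > 0 \<and> p \<in> dyck_paths_from (h - 1) n"
    by (auto simp: dyck_paths_from_def all_le_Suc algebra_simps of_nat_diff)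
qed

lemma dyck_paths_from_Suc_0: "dyck_paths_from 0 (Suc n) = (#) Rise ` dyck_paths_from 1 n"
proof -
  have "p \<in> dyck_paths_from 0 (Suc n) \<longleftrightarrow> p \<in> (#) Rise ` dyck_paths_from 1 n" for p
  proof (cases p)
    case (Cons s q)
    then show ?thesis by (cases s) (auto simp: Cons_mem_dyck_paths_from)
  qed (auto simp: dyck_paths_from_def)
  then show ?thesis by blast
qed

lemma dyck_paths_from_Suc_Suc:
  "dyck_paths_from (Suc h) (Suc n) =
     (#) Fall ` dyck_paths_from h n \<union> (#) Rise ` dyck_paths_from (Suc (Suc h)) n"
proof -
  have "p \<in> dyck_paths_from (Suc h) (Suc n) \<longleftrightarrow>
      p \<in> (#) Fall ` dyck_paths_from h n \<union> (#) Rise ` dyck_paths_from (Suc (Suc h)) n" for p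
  proof (cases p)
    case (Cons s q)
    then show ?thesis by (cases s) (auto simp: Cons_mem_dyck_paths_from)
  qed (auto simp: dyck_paths_from_def)
  then show ?thesis by blast
qed

lemma finite_dyck_paths_from [simp]: "finite (dyck_paths_from h n)"
proof (induction n arbitrary: h)
  case 0
  then show ?case by (simp add: dyck_paths_from_0)
next
  case (Suc n)
  then show ?case by (cases h) (simp_all add: dyck_paths_from_Suc_0 dyck_paths_from_Suc_Suc)
qed

lemma sum_dyck_paths_from_Suc_0:
  "sum f (dyck_paths_from 0 (Suc n)) = (\<Sum>p\<in>dyck_paths_from 1 n. f (Rise # p))"
  unfolding dyck_paths_from_Suc_0 by (subst sum.reindex) simp_all

lemma sum_dyck_paths_from_Suc_Suc:
  "sum f (dyck_paths_from (Suc h) (Suc n)) =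
     (\<Sum>p\<in>dyck_paths_from h n. f (Fall # p)) +
     (\<Sum>p\<in>dyck_paths_from (Suc (Suc h)) n. f (Rise # p))"
  unfolding dyck_paths_from_Suc_Suc
  by (subst sum.union_disjoint) (auto simp: sum.reindex)

lemma card_dyck_paths_from: "card (dyck_paths_from h n) = ballot n h"
  unfolding card_eq_sum
  by (induction n h rule: ballot.induct)
    (simp_all add: dyck_paths_from_0 sum_dyck_paths_from_Suc_0 sum_dyck_paths_from_Suc_Suc
      del: sum_constant)

text \<open>The level is relative to the starting point of the path, so it can be negative.\<close>

definition level_rises :: "int \<Rightarrow> step list \<Rightarrow> nat" where
  "level_rises a p = card {j. j < length p \<and> p ! j = Rise \<and> altitude p j = a}"

lemma rises_eq_level_rises: "rises i p = level_rises (int i) p"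
  unfolding rises_def level_rises_def
  by (rule arg_cong[where f = card]) (auto simp: altitude_Suc)

lemma card_less_Suc_shift:
  "card {j. j < Suc n \<and> P j} = (if P 0 then 1 else 0) + card {j. j < n \<and> P (Suc j)}"
proof -
  have "{j. j < Suc n \<and> P j} = (if P 0 then {0} else {}) \<union> Suc ` {j. j < n \<and> P (Suc j)}"
    by (auto simp: less_Suc_eq_0_disj)
  then show ?thesis by (simp add: card_image)
qed

lemma level_rises_Nil [simp]: "level_rises a [] = 0"
  by (simp add: level_rises_def)

lemma level_rises_Cons [simp]:
  "level_rises a (Rise # p) = (if a = 0 then 1 else 0) + level_rises (a - 1) p"
  "level_rises a (Fall # p) = level_rises (a + 1) p"
  unfolding level_rises_def length_Cons card_less_Suc_shift
  by (simp_all add: algebra_simps eq_diff_eq)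

text \<open>By the reflection principle, the number of nonnegative paths with \<open>n\<close> steps from altitude \<open>h\<close>
  to altitude \<open>i\<close> is the sum of \<open>ballot n (h + i - 2 * t)\<close> over \<open>t \<le> min h i\<close>, and convolving
  with \<open>ballot\<close> at altitude \<open>i + 1\<close> adds \<open>i + 2\<close> to the second argument.\<close>

lemma sum_level_rises:
  "(\<Sum>p\<in>dyck_paths_from h n. level_rises (int i - int h) p) =
     (\<Sum>t\<le>min h i. ballot n (2 * i + 2 + h - 2 * t))"
proof (induction n arbitrary: h)
  case 0
  then show ?case by (auto simp: dyck_paths_from_0)
next
  case (Suc n)
  let ?S = "\<lambda>h. \<Sum>t\<le>min h i. ballot n (2 * i + 2 + h - 2 * t)"
  have split: "(\<Sum>t\<le>min h i. ballot (Suc n) (2 * i + 2 + h - 2 * t)) =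
      (\<Sum>t\<le>min h i. ballot n (2 * i + 1 + h - 2 * t)) +
      (\<Sum>t\<le>min h i. ballot n (2 * i + 3 + h - 2 * t))"
    unfolding sum.distrib[symmetric]
  proof (rule sum.cong[OF refl])
    fix t assume "t \<in> {..min h i}"
    then have "2 * i + 2 + h - 2 * t = Suc (2 * i + 1 + h - 2 * t)"
      "2 * i + 3 + h - 2 * t = Suc (Suc (2 * i + 1 + h - 2 * t))" by auto
    then show "ballot (Suc n) (2 * i + 2 + h - 2 * t) =
        ballot n (2 * i + 1 + h - 2 * t) + ballot n (2 * i + 3 + h - 2 * t)"
      by (simp only: ballot.simps)
  qed
  \<comment> \<open>Passing to \<open>Suc h\<close> adds the index \<open>t = Suc h\<close> exactly
    when \<open>h < i\<close>.\<close>
  have up: "(\<Sum>t\<le>min h i. ballot n (2 * i + 3 + h - 2 * t)) +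
      (if h < i then ballot n (2 * i + 1 - h) else 0) = ?S (Suc h)"
    by (auto simp: min_def le_Suc_eq not_less eval_nat_numeral)
  \<comment> \<open>If \<open>h = i\<close>, the initial rise itself counts once per path, and
    \<open>2 * i + 1 - h\<close> equals \<open>Suc h\<close>.\<close>
  have rise: "(\<Sum>p\<in>dyck_paths_from (Suc h) n. level_rises (int i - int h) (Rise # p)) =
      (if h = i then ballot n (2 * i + 1 - h) else 0) + ?S (Suc h)"
    using Suc.IH[of "Suc h"]
    by (simp add: sum.distrib algebra_simps card_dyck_paths_from)
  show ?case
  proof (cases h)
    case 0
    then show ?thesis
      using split up rise by (simp add: sum_dyck_paths_from_Suc_0 split: if_splits)
  next
    case (Suc h')
    \<comment> \<open>The extra term \<open>t = h\<close> pays for the extra term of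
      \<open>up\<close> if \<open>h < i\<close> and for the initial rise if
      \<open>h = i\<close>.\<close>
    have down: "(\<Sum>t\<le>min h i. ballot n (2 * i + 1 + h - 2 * t)) =
        ?S h' + (if h \<le> i then ballot n (2 * i + 1 - h) else 0)"
      by (auto simp: Suc min_def not_less_eq_eq dest: le_antisym)
    have fall: "(\<Sum>p\<in>dyck_paths_from h' n. level_rises (int i - int h) (Fall # p)) = ?S h'"
      using Suc.IH[of h'] Suc by simp
    have step: "(\<Sum>p\<in>dyck_paths_from h (Suc n). level_rises (int i - int h) p) =
        (\<Sum>p\<in>dyck_paths_from h' n. level_rises (int i - int h) (Fall # p)) +
        (\<Sum>p\<in>dyck_paths_from (Suc h) n. level_rises (int i - int h) (Rise # p))"
      unfolding Suc by (rule sum_dyck_paths_from_Suc_Suc)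
    show ?thesis
      unfolding step fall rise split down up[symmetric] by simp
  qed
qed

text \<open>Starting at altitude 0 leaves only \<open>t = 0\<close> in the general formula.\<close>

lemma sum_rises: "(\<Sum>p\<in>dyck_paths k. rises i p) = ballot (2 * k) (2 * i + 2)"
  using sum_level_rises[where h = 0 and n = "2 * k" and i = i]
  by (simp add: dyck_paths_eq rises_eq_level_rises)

lemma expected_rises_eq:
  "expected_rises k i = (\<Sum>p\<in>dyck_paths k. real (rises i p)) / catalan k"
proof -
  have "real (card (dyck_paths k)) = catalan k"
    by (simp add: catalan_eq_ballot dyck_paths_eq card_dyck_paths_from)
  then show ?thesis
    unfolding expected_rises_def
    by (simp add: integral_pmf_of_set finite_dyck_paths dyck_paths_nonempty)
qed

theorem theorem1:
  fixes k :: nat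
  assumes "k \<ge> 1"
  shows "(L2_set (expected_rises k) {0..k - 1})\<^sup>2 =
           1 / (catalan k)\<^sup>2 *
             (\<Sum>p1\<in>dyck_paths k. \<Sum>p2\<in>dyck_paths k. \<Sum>i=0..k - 1.
                real (rises i p1) * real (rises i p2))
       \<and> 1 / (catalan k)\<^sup>2 *
             (\<Sum>p1\<in>dyck_paths k. \<Sum>p2\<in>dyck_paths k. \<Sum>i=0..k - 1.
                real (rises i p1) * real (rises i p2)) =
           catalan (2 * k) / (catalan k)\<^sup>2 - 1"
proof -
  let ?T = "\<lambda>i. \<Sum>p\<in>dyck_paths k. real (rises i p)"
  \<comment> \<open>At \<open>k = 0\<close> the truncated \<open>k - 1\<close> would leave the index
    0 in the interval.\<close>
  have range: "{0..k - 1} = {..<k}" using assms by auto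
  have "(\<Sum>p1\<in>dyck_paths k. \<Sum>p2\<in>dyck_paths k. \<Sum>i=0..k - 1.
      real (rises i p1) * real (rises i p2)) =
      (\<Sum>p1\<in>dyck_paths k. \<Sum>i<k. \<Sum>p2\<in>dyck_paths k. real (rises i p1) * real (rises i p2))"
    unfolding range by (rule sum.cong[OF refl], rule sum.swap)
  also have "\<dots> = (\<Sum>i<k. \<Sum>p1\<in>dyck_paths k. \<Sum>p2\<in>dyck_paths k.
      real (rises i p1) * real (rises i p2))"
    by (rule sum.swap)
  finally have pairs: "(\<Sum>p1\<in>dyck_paths k. \<Sum>p2\<in>dyck_paths k. \<Sum>i=0..k - 1.
      real (rises i p1) * real (rises i p2)) = (\<Sum>i<k. (?T i)\<^sup>2)"
    by (simp add: power2_eq_square sum_product)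
  have "?T i = real (ballot (2 * k) (2 * i + 2))" for i
    by (metis of_nat_sum sum_rises)
  then have total: "(\<Sum>i<k. (?T i)\<^sup>2) = catalan (2 * k) - (catalan k)\<^sup>2"
    using arg_cong[OF ballot_square_sum[of k], of real] by (simp add: catalan_eq_ballot)
  have "catalan k \<noteq> 0" by (simp add: catalan_def)
  then have "1 / (catalan k)\<^sup>2 * (\<Sum>i<k. (?T i)\<^sup>2) = catalan (2 * k) / (catalan k)\<^sup>2 - 1"
    unfolding total by (simp add: field_simps)
  moreover have "(L2_set (expected_rises k) {0..k - 1})\<^sup>2 =
      1 / (catalan k)\<^sup>2 * (\<Sum>i<k. (?T i)\<^sup>2)"
    unfolding range L2_set_def
    by (simp add: sum_nonneg expected_rises_eq power_divide flip: sum_divide_distrib)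
  ultimately show ?thesis unfolding pairs by simp
qed

end
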